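(* Let $0<q<1$ and let $a,b$ be real with $0<a<1$, $b<1$. Define matrices $P^q,L^q,U^q$ with rows and columns indexed by $\mathbb{Z}_{\ge0}$ by $$P_{n,x}^q:=p_n^{a,b;q}(x),\qquad U_{k,x}^q:=(q^x;q^{-1})_k,$$ $$L_{n,k}^q:=q^{\frac12(n-k)(n-k-1)}\,(-a)^{n-k}\,\frac{(bq^k;q)_{n-k}\,(abq^{n-1};q)_k}{(a;q)_n\,(q;q)_k}\,(q^n;q^{-1})_k\quad(k\le n),\qquad L^q_{n,k}:=0\quad(k>n).$$ Then $L^q$ is lower triangular, $U^q$ is upper triangular and $P^q=L^qU^q$, i.e. for all $n,x\in\mathbb{Z}_{\ge0}$ $$p_n^{a,b;q}(x)=\sum_{k=0}^{\min(n,x)}q^{\frac12(n-k)(n-k-1)}\,(-a)^{n-k}\,\frac{(bq^k;q)_{n-k}\,(abq^{n-1};q)_k}{(a;q)_n\,(q;q)_k}\,(q^n;q^{-1})_k\,(q^x;q^{-1})_k.$$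
   Context: For $k\in\mathbb{Z}_{\ge0}$ write $(c;q)_k:=\prod_{i=0}^{k-1}(1-cq^i)$ and correspondingly $(c;q^{-1})_k:=\prod_{i=0}^{k-1}(1-cq^{-i})$. The (reparametrized) little $q$-Jacobi polynomials are, for $n,x\in\mathbb{Z}_{\ge0}$, $$p_n^{a,b;q}(x):={}_2\phi_1\left(q^{-n},abq^{n-1};a;q,q^{x+1}\right)=\sum_{k=0}^n\frac{(q^{-n};q)_k\,(abq^{n-1};q)_k}{(a;q)_k\,(q;q)_k}\,q^{(x+1)k}.$$ A matrix $M$ is lower (upper) triangular if $M_{i,j}=0$ whenever $i<j$ (respectively $i>j$). *)

theory Defs
  imports Complex_Main
begin

definition qpoch :: "real \<Rightarrow> real \<Rightarrow> nat \<Rightarrow> real" where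
  "qpoch c q k = (\<Prod>i<k. 1 - c * q ^ i)"

definition phi21 :: "real \<Rightarrow> real \<Rightarrow> real \<Rightarrow> real \<Rightarrow> real \<Rightarrow> real" where
  "phi21 \<alpha> \<beta> \<gamma> q z =
     (\<Sum>k. qpoch \<alpha> q k * qpoch \<beta> q k / (qpoch \<gamma> q k * qpoch q q k) * z ^ k)"

definition little_q_jacobi :: "real \<Rightarrow> real \<Rightarrow> real \<Rightarrow> nat \<Rightarrow> nat \<Rightarrow> real" where
  "little_q_jacobi a b q n x =
     phi21 (q powi (- int n)) (a * b * q powi (int n - 1)) a q (q ^ (x + 1))"

lemma qpoch_terminates:
  assumes "q \<noteq> 0" and "n < k"
  shows "qpoch (q powi (- int n)) q k = 0"
proof -
  have "1 - q powi (- int n) * q ^ n = 0"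
    using assms(1) by (simp add: power_int_minus)
  then show ?thesis
    unfolding qpoch_def using assms(2) by (intro prod_zero) auto
qed

lemma little_q_jacobi_finite_sum:
  assumes "q \<noteq> 0"
  shows "little_q_jacobi a b q n x =
     (\<Sum>k=0..n. qpoch (q powi (- int n)) q k * qpoch (a * b * q powi (int n - 1)) q k
               / (qpoch a q k * qpoch q q k) * q ^ ((x + 1) * k))"
proof -
  have "little_q_jacobi a b q n x =
     (\<Sum>k\<in>{0..n}. qpoch (q powi (- int n)) q k * qpoch (a * b * q powi (int n - 1)) q k
               / (qpoch a q k * qpoch q q k) * (q ^ (x + 1)) ^ k)"
    unfolding little_q_jacobi_def phi21_def
    by (rule suminf_finite) (auto simp: qpoch_terminates[OF assms])
  then show ?thesis
    by (simp only: power_mult)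
qed

type_synonym inf_matrix = "nat \<Rightarrow> nat \<Rightarrow> real"

definition lower_triangular :: "inf_matrix \<Rightarrow> bool" where
  "lower_triangular M \<longleftrightarrow> (\<forall>i j. i < j \<longrightarrow> M i j = 0)"

definition upper_triangular :: "inf_matrix \<Rightarrow> bool" where
  "upper_triangular M \<longleftrightarrow> (\<forall>i j. i > j \<longrightarrow> M i j = 0)"

(* When A is lower triangular or B is upper triangular, only finitely many
   terms of each entry are nonzero, so convergence is not an issue. *)
definition inf_matrix_mult :: "inf_matrix \<Rightarrow> inf_matrix \<Rightarrow> inf_matrix" where
  "inf_matrix_mult A B = (\<lambda>i j. \<Sum>k. A i k * B k j)"

definition P_mat :: "real \<Rightarrow> real \<Rightarrow> real \<Rightarrow> inf_matrix" where
  "P_mat a b q n x = little_q_jacobi a b q n x"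

definition U_mat :: "real \<Rightarrow> inf_matrix" where
  "U_mat q k x = qpoch (q ^ x) (inverse q) k"

definition L_mat :: "real \<Rightarrow> real \<Rightarrow> real \<Rightarrow> inf_matrix" where
  "L_mat a b q n k =
     (if k \<le> n then
        q ^ ((n - k) * (n - k - 1) div 2) * (- a) ^ (n - k)
        * (qpoch (b * q ^ k) q (n - k) * qpoch (a * b * q powi (int n - 1)) q k
           / (qpoch a q n * qpoch q q k))
        * qpoch (q ^ n) (inverse q) k
      else 0)"

end

(* Expand the powers of y = q^x occurring in p_n in the basis (y; q^{-1})_k, with q-binomial
   coefficients. After exchanging the two summations, the coefficient of (y; q^{-1})_k is a
   terminating 2phi1 at argument q, which the q-Chu-Vandermonde formula evaluates. *)
theory Submission
  imports Defs
begin

section \<open>q-Pochhammer symbols: splitting and zeros\<close>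

lemma qpoch_0 [simp]: "qpoch c q 0 = 1"
  by (simp add: qpoch_def)

lemma qpoch_Suc: "qpoch c q (Suc k) = qpoch c q k * (1 - c * q ^ k)"
  by (simp add: qpoch_def)

lemma qpoch_add: "qpoch c q (m + n) = qpoch c q m * qpoch (c * q ^ m) q n"
  by (induction n) (simp_all add: qpoch_Suc power_add mult_ac)

lemma qpoch_Suc_shift: "qpoch c q (Suc k) = (1 - c) * qpoch (c * q) q k"
  using qpoch_add[of c q 1 k] by (simp add: qpoch_Suc)

lemma mult_power_less_one:
  fixes c q :: "'a :: linordered_field"
  assumes "0 < q" "q < 1" "c < 1"
  shows "c * q ^ i < 1"
proof (cases "0 \<le> c")
  case True
  then have "c * q ^ i \<le> c * 1"
    using assms by (intro mult_left_mono power_le_one) auto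
  also have "\<dots> < 1" using assms by simp
  finally show ?thesis .
next
  case False
  then have "c * q ^ i < 0" using assms by (simp add: mult_neg_pos)
  then show ?thesis by simp
qed

text \<open>Every factor is positive. Applied to \<open>a\<close>, \<open>q\<close> and their shifts
  by powers of \<open>q\<close>, this justifies all later divisions.\<close>

lemma qpoch_neq_0:
  assumes "0 < q" "q < 1" "c < 1"
  shows "qpoch c q k \<noteq> 0"
  using mult_power_less_one[OF assms] by (auto simp: qpoch_def dest: less_imp_neq)

text \<open>The factor with index \<open>x\<close> is 1 - q^x q^(-x) = 0, which is why
  \<open>U_mat\<close> is upper triangular.\<close>

lemma qpoch_inverse_eq_0:
  assumes "q \<noteq> 0" "x < k"
  shows "qpoch (q ^ x) (inverse q) k = 0"
  unfolding qpoch_def using assms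
  by (intro prod_zero) (auto intro!: bexI[of _ x] simp: power_inverse)

section \<open>Gaussian binomial coefficients and the expansion of powers\<close>

fun qbinom :: "real \<Rightarrow> nat \<Rightarrow> nat \<Rightarrow> real" where
  "qbinom q n 0 = 1"
| "qbinom q 0 (Suc k) = 0"
| "qbinom q (Suc n) (Suc k) = q ^ Suc k * qbinom q n (Suc k) + qbinom q n k"

lemma qbinom_eq_0: "n < k \<Longrightarrow> qbinom q n k = 0"
  by (induction q n k rule: qbinom.induct) auto

lemma qbinom_self [simp]: "qbinom q n n = 1"
  by (induction n) (auto simp: qbinom_eq_0)

text \<open>The q-factorial formula, cleared of denominators so that it holds for every
  \<open>q\<close>. In the induction on \<open>k + m\<close>, the two terms of the q-Pascal rule
  contribute the factors q^k (1 - q^m) and 1 - q^k, whose sum is 1 - q^(k+m).\<close>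

lemma qbinom_qpoch:
  "qbinom q (k + m) k * (qpoch q q k * qpoch q q m) = qpoch q q (k + m)"
proof (induction "k + m" arbitrary: k m)
  case 0
  then show ?case by simp
next
  case (Suc n)
  show ?case
  proof (cases k)
    case 0
    then show ?thesis by simp
  next
    case k: (Suc k')
    show ?thesis
    proof (cases m)
      case 0
      then show ?thesis by simp
    next
      case m: (Suc m')
      have n: "n = k + m'" "n = k' + m" "k + m = Suc n"
        using Suc k m by auto
      have a: "qbinom q n k * (qpoch q q k * qpoch q q m') = qpoch q q n"
        using Suc.hyps(1)[OF n(1)] n(1) by simp
      have b: "qbinom q n k' * (qpoch q q k' * qpoch q q m) = qpoch q q n"
        using Suc.hyps(1)[OF n(2)] n(2) by simp
      have "qbinom q (k + m) k * (qpoch q q k * qpoch q q m)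
          = q ^ k * (1 - q * q ^ m') * (qbinom q n k * (qpoch q q k * qpoch q q m'))
            + (1 - q * q ^ k') * (qbinom q n k' * (qpoch q q k' * qpoch q q m))"
        unfolding n by (simp add: k m qpoch_Suc algebra_simps)
      also have "\<dots> = (q ^ k * (1 - q * q ^ m') + (1 - q * q ^ k')) * qpoch q q n"
        unfolding a b by (simp add: algebra_simps)
      also have "q ^ k * (1 - q * q ^ m') + (1 - q * q ^ k') = 1 - q * q ^ n"
        by (simp add: n(1) k power_add algebra_simps)
      finally show ?thesis by (simp add: n(3) qpoch_Suc)
    qed
  qed
qed

text \<open>Induction on \<open>j\<close>: multiplication by \<open>y\<close> sends the basis
  element Y_k to q^k (Y_k - Y_(k+1)), and collecting coefficients reproduces the q-Pascal rule. The
  product over \<open>i\<close> is (-1)^k q^(k(k-1)/2).\<close>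

lemma power_eq_sum_qpoch_inverse:
  assumes "q \<noteq> 0"
  shows "y ^ j = (\<Sum>k\<le>j. (\<Prod>i<k. - (q ^ i)) * qbinom q j k * qpoch y (inverse q) k)"
proof (induction j)
  case 0
  then show ?case by simp
next
  case (Suc j)
  define w where "w k = (\<Prod>i<k. - (q ^ i))" for k
  define Y where "Y = qpoch y (inverse q)"
  have w: "w (Suc k) = - w k * q ^ k" "w 0 = 1" for k
    by (simp_all add: w_def)
  have Y: "q ^ k * Y (Suc k) = (q ^ k - y) * Y k" for k
    using assms by (simp add: Y_def qpoch_Suc field_simps power_inverse)
  have Y0: "Y 0 = 1" by (simp add: Y_def)
  have "(\<Sum>k\<le>Suc j. w k * qbinom q (Suc j) k * Y k)
      = 1 + (\<Sum>k\<le>j. w (Suc k) * q ^ Suc k * qbinom q j (Suc k) * Y (Suc k))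
          + (\<Sum>k\<le>j. w (Suc k) * qbinom q j k * Y (Suc k))"
    by (simp add: sum.atMost_Suc_shift w(2) Y0 sum.distrib[symmetric] algebra_simps
        del: sum.atMost_Suc)
  \<comment> \<open>The isolated 1 is the term \<open>k = 0\<close>, so the index can be shifted
    back; the new top term \<open>k = Suc j\<close> then drops out because its q-binomial is
    zero.\<close>
  also have "1 + (\<Sum>k\<le>j. w (Suc k) * q ^ Suc k * qbinom q j (Suc k) * Y (Suc k))
      = (\<Sum>k\<le>Suc j. w k * q ^ k * qbinom q j k * Y k)"
    by (simp add: sum.atMost_Suc_shift w(2) Y0 del: sum.atMost_Suc)
  also have "\<dots> = (\<Sum>k\<le>j. w k * q ^ k * qbinom q j k * Y k)"
    by (simp add: qbinom_eq_0)
  also have "\<dots> + (\<Sum>k\<le>j. w (Suc k) * qbinom q j k * Y (Suc k))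
      = (\<Sum>k\<le>j. w k * qbinom q j k * (q ^ k * Y k - q ^ k * Y (Suc k)))"
    by (simp add: w sum.distrib[symmetric] algebra_simps)
  also have "\<dots> = y * (\<Sum>k\<le>j. w k * qbinom q j k * Y k)"
    unfolding Y by (simp add: sum_distrib_left algebra_simps)
  finally show ?case
    using Suc by (simp only: w_def[symmetric] Y_def[symmetric] power_Suc)
qed

section \<open>The q-Chu-Vandermonde sum\<close>

text \<open>The product on the right is B^N (C/B; q)_N written without division, so
  \<open>B = 0\<close> is covered; this is needed when b = 0. Raising \<open>N\<close> by one
  changes the sum by a multiple of the same sum for \<open>N\<close>, \<open>B * q\<close>,
  \<open>C * q\<close>, hence an induction with \<open>B\<close> and \<open>C\<close>
  arbitrary.\<close>

lemma q_Chu_Vandermonde: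
  assumes "0 < q" "q < 1" "C < 1"
  shows "(\<Sum>m\<le>N. qpoch (inverse (q ^ N)) q m * qpoch B q m / (qpoch C q m * qpoch q q m) * q ^ m)
       = (\<Prod>i<N. B - C * q ^ i) / qpoch C q N"
  using assms(3)
proof (induction N arbitrary: B C)
  case 0
  then show ?case by simp
next
  case (Suc N)
  define r where "r = inverse (q ^ N)"
  define s where "s = inverse (q ^ Suc N)"
  have sq: "s * q = r"
    using assms by (simp add: r_def s_def)
  have Cq: "C * q < 1"
    using mult_power_less_one[OF assms(1,2) Suc.prems, of 1] by simp
  have nzC: "qpoch C q m \<noteq> 0" for m
    by (rule qpoch_neq_0[OF assms(1,2) Suc.prems])
  have nzCq: "qpoch (C * q) q m \<noteq> 0" for m
    by (rule qpoch_neq_0[OF assms(1,2) Cq])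
  have nzq: "qpoch q q m \<noteq> 0" for m
    by (rule qpoch_neq_0[OF assms(1,2,2)])
  have nzq': "1 - q * q ^ m \<noteq> 0" for m
    using nzq[of "Suc m"] by (auto simp: qpoch_Suc)
  define t where "t c m = qpoch c q m * qpoch B q m / (qpoch C q m * qpoch q q m) * q ^ m" for c m
  \<comment> \<open>As \<open>s * q = r\<close>, the symbols of \<open>s\<close> and
    \<open>r\<close> of length \<open>Suc m\<close> share the factor \<open>qpoch r q m\<close>.
    What remains of their difference contains 1 - q^(m+1), which cancels against the last factor of
    \<open>qpoch q q (Suc m)\<close>.\<close>
  have diff: "t s (Suc m) - t r (Suc m)
      = - (r * (1 - B) / (1 - C)) *
        (qpoch r q m * qpoch (B * q) q m / (qpoch (C * q) q m * qpoch q q m) * q ^ m)" for m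
  proof -
    have "qpoch s q (Suc m) - qpoch r q (Suc m) = qpoch r q m * ((1 - s) - (1 - r * q ^ m))"
      unfolding qpoch_Suc_shift[of s] qpoch_Suc[of r] sq by (simp add: algebra_simps)
    also have "\<dots> = - qpoch r q m * s * (1 - q * q ^ m)"
      by (simp add: sq[symmetric] algebra_simps)
    finally have d: "qpoch s q (Suc m) - qpoch r q (Suc m) = - qpoch r q m * s * (1 - q * q ^ m)" .
    have "t s (Suc m) - t r (Suc m) = (qpoch s q (Suc m) - qpoch r q (Suc m)) * qpoch B q (Suc m)
        / (qpoch C q (Suc m) * qpoch q q (Suc m)) * q ^ Suc m"
      by (simp add: t_def diff_divide_distrib left_diff_distrib)
    also have "\<dots> = - qpoch r q m * (s * q) * (1 - q * q ^ m) * ((1 - B) * qpoch (B * q) q m)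
        / ((1 - C) * qpoch (C * q) q m * (qpoch q q m * (1 - q * q ^ m))) * q ^ m"
      unfolding d by (simp add: qpoch_Suc_shift[of B] qpoch_Suc_shift[of C] qpoch_Suc[of q])
    also have "\<dots> = - (r * (1 - B) / (1 - C)) *
        (qpoch r q m * qpoch (B * q) q m / (qpoch (C * q) q m * qpoch q q m) * q ^ m)"
      using nzq'[of m] unfolding sq by simp
    finally show ?thesis .
  qed
  \<comment> \<open>The factor 1 - r q^N vanishes, so the sum for \<open>r\<close> may run to
    \<open>Suc N\<close> without changing its value.\<close>
  have last: "t r (Suc N) = 0"
    using assms by (simp add: t_def qpoch_Suc r_def)
  have IH: "(\<Sum>m\<le>N. t r m) = (\<Prod>i<N. B - C * q ^ i) / qpoch C q N"
    unfolding t_def r_def by (rule Suc.IH[OF Suc.prems])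
  have scale: "(\<Prod>i<N. B * q - C * q * q ^ i) = q ^ N * (\<Prod>i<N. B - C * q ^ i)"
  proof -
    have "(\<Prod>i<N. B * q - C * q * q ^ i) = (\<Prod>i<N. q * (B - C * q ^ i))"
      by (intro prod.cong) (auto simp: algebra_simps)
    then show ?thesis by (simp add: prod.distrib)
  qed
  have "(\<Sum>m\<le>Suc N. t s m) = (\<Sum>m\<le>Suc N. t r m) + (\<Sum>m\<le>Suc N. t s m - t r m)"
    by (simp add: sum_subtractf)
  also have "(\<Sum>m\<le>Suc N. t s m - t r m) = (\<Sum>m\<le>N. t s (Suc m) - t r (Suc m))"
    by (simp add: sum.atMost_Suc_shift t_def del: sum.atMost_Suc)
  also have "\<dots> = - (r * (1 - B) / (1 - C)) *
      ((\<Prod>i<N. B * q - C * q * q ^ i) / qpoch (C * q) q N)"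
    unfolding diff sum_distrib_left[symmetric] Suc.IH[OF Cq, of "B * q", folded r_def] ..
  also have "\<dots> = - (1 - B) * (\<Prod>i<N. B - C * q ^ i) / qpoch C q (Suc N)"
  proof -
    have "- (r * e / d) * (q ^ N * p / X) = - e * p / (d * X)" for e d p X
      using assms by (simp add: r_def field_simps)
    then show ?thesis
      unfolding scale qpoch_Suc_shift[of C] .
  qed
  also have "(\<Sum>m\<le>Suc N. t r m) = (\<Prod>i<N. B - C * q ^ i) * (1 - C * q ^ N) / qpoch C q (Suc N)"
    using last IH nzC[of "Suc N"] by (simp add: qpoch_Suc)
  \<comment> \<open>The numerators combine by (1 - C q^N) - (1 - B) = B - C q^N, the new factor of
    the product.\<close>
  also have "\<dots> + - (1 - B) * (\<Prod>i<N. B - C * q ^ i) / qpoch C q (Suc N)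
      = (\<Prod>i<Suc N. B - C * q ^ i) / qpoch C q (Suc N)"
    unfolding add_divide_distrib[symmetric] by (simp add: algebra_simps)
  finally show ?case unfolding t_def s_def .
qed

section \<open>Closed form of the coefficients\<close>

text \<open>Factor by factor, 1 - q^(i-n) = - q^(i-n) (1 - q^(n-i)). The powers of \<open>q\<close>
  are distributed over both sides so that all their exponents are natural numbers.\<close>

lemma qpoch_inverse_power:
  assumes "q \<noteq> 0"
  shows "qpoch (inverse (q ^ n)) q k * (\<Prod>i<k. - (q ^ i)) * q ^ (k * Suc n)
       = qpoch (q ^ n) (inverse q) k * q ^ (k * k)"
proof (induction k)
  case 0
  then show ?case by simp
next
  case (Suc k)
  have "qpoch (inverse (q ^ n)) q (Suc k) * (\<Prod>i<Suc k. - (q ^ i)) * q ^ (Suc k * Suc n)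
      = (qpoch (inverse (q ^ n)) q k * (\<Prod>i<k. - (q ^ i)) * q ^ (k * Suc n))
        * ((1 - inverse (q ^ n) * q ^ k) * (- (q ^ k)) * q ^ Suc n)"
    by (simp add: qpoch_Suc power_add algebra_simps)
  also have "(1 - inverse (q ^ n) * q ^ k) * (- (q ^ k)) * q ^ Suc n
      = (1 - q ^ n * inverse q ^ k) * q ^ (k + Suc k)"
    using assms by (simp add: field_simps power_add power_inverse)
  also have "qpoch (inverse (q ^ n)) q k * (\<Prod>i<k. - (q ^ i)) * q ^ (k * Suc n)
      = qpoch (q ^ n) (inverse q) k * q ^ (k * k)"
    by (rule Suc)
  finally show ?case
    by (simp add: qpoch_Suc power_add algebra_simps)
qed

lemma prod_power_lessThan: "(\<Prod>i<n. q ^ i) = (q :: 'a :: comm_semiring_1) ^ (n * (n - 1) div 2)"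
proof -
  have "(\<Prod>i<n. q ^ i) = q ^ (\<Sum>i<n. i)"
    by (simp add: power_sum)
  also have "(\<Sum>i<n. i) = n * (n - 1) div 2"
    by (cases n) (simp_all add: lessThan_Suc_atMost atMost_atLeast0 gauss_sum_nat mult.commute)
  finally show ?thesis .
qed

text \<open>This is the numerator of q-Chu-Vandermonde for the parameters met below. Pulling - a
  q^(k+i) out of factor \<open>i\<close> leaves 1 - b q^(k+N-1-i), so the factors of
  \<open>qpoch (b * q ^ k) q N\<close> appear in reverse order.\<close>

lemma prod_diff_eq_qpoch:
  "(\<Prod>i<N. a * b * q powi (int (k + N) - 1) * q ^ k - a * q ^ k * q ^ i)
   = (- a) ^ N * q ^ (k * N) * q ^ (N * (N - 1) div 2) * qpoch (b * q ^ k) q N"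
proof -
  have "(\<Prod>i<N. a * b * q powi (int (k + N) - 1) * q ^ k - a * q ^ k * q ^ i)
      = (\<Prod>i<N. (- a * q ^ k) * q ^ i * (1 - b * q ^ k * q ^ (N - Suc i)))"
  proof (intro prod.cong refl)
    fix i assume "i \<in> {..<N}"
    \<comment> \<open>The exponent is negative only for \<open>k + N = 0\<close>, and then the
      product is empty; here \<open>i < N\<close> rules this out.\<close>
    then have "int (k + N) - 1 = int (i + k + (N - Suc i))" by auto
    then have "q powi (int (k + N) - 1) = q ^ (i + k + (N - Suc i))"
      by (simp only: power_int_of_nat)
    then show "a * b * q powi (int (k + N) - 1) * q ^ k - a * q ^ k * q ^ i
        = (- a * q ^ k) * q ^ i * (1 - b * q ^ k * q ^ (N - Suc i))"
      by (simp add: power_add algebra_simps)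
  qed
  also have "\<dots> = (- a * q ^ k) ^ N * (\<Prod>i<N. q ^ i) * (\<Prod>i<N. 1 - b * q ^ k * q ^ (N - Suc i))"
    by (simp only: prod.distrib prod_constant card_lessThan power_mult_distrib)
  also have "(\<Prod>i<N. 1 - b * q ^ k * q ^ (N - Suc i)) = qpoch (b * q ^ k) q N"
    unfolding qpoch_def by (rule prod.nat_diff_reindex)
  also have "(- a * q ^ k) ^ N = (- a) ^ N * q ^ (k * N)"
    by (simp only: power_mult_distrib power_mult)
  finally show ?thesis by (simp add: prod_power_lessThan)
qed

lemma sum_triangle_shift:
  fixes f :: "nat \<Rightarrow> nat \<Rightarrow> 'a :: comm_monoid_add"
  shows "(\<Sum>j\<le>n. \<Sum>k\<le>j. f j k) = (\<Sum>k\<le>n. \<Sum>m\<le>n - k. f (k + m) k)"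
  unfolding sum.Sigma[OF finite_atMost ballI[OF finite_atMost]]
  by (rule sum.reindex_bij_witness[of _ "\<lambda>(k, m). (k + m, k)" "\<lambda>(j, k). (k, j - k)"]) auto

text \<open>The left side collects the contributions of the powers \<open>j = k + m\<close> to the
  basis element of index \<open>k\<close>. Splitting each symbol at \<open>k\<close> separates a
  prefactor free of \<open>m\<close> from a terminating 2phi1 with parameters q^(-N), \<beta> q^k, a
  q^k and argument \<open>q\<close>.\<close>

lemma little_q_jacobi_coefficient:
  fixes a b q :: real and k N :: nat
  assumes "0 < q" "q < 1" "a < 1"
  defines "n \<equiv> k + N" and "\<beta> \<equiv> a * b * q powi (int (k + N) - 1)"
  shows "(\<Sum>m\<le>N. qpoch (inverse (q ^ n)) q (k + m) * qpoch \<beta> q (k + m)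
            / (qpoch a q (k + m) * qpoch q q (k + m)) * q ^ (k + m)
            * ((\<Prod>i<k. - (q ^ i)) * qbinom q (k + m) k))
       = L_mat a b q n k"
proof -
  define w where "w = (\<Prod>i<k. - (q ^ i))"
  define r where "r = inverse (q ^ n)"
  have rq: "r * q ^ k = inverse (q ^ N)"
    using assms by (simp add: r_def n_def power_add field_simps)
  have nza: "qpoch a q m \<noteq> 0" for m
    by (rule qpoch_neq_0[OF assms(1-3)])
  have nzq: "qpoch q q m \<noteq> 0" for m
    by (rule qpoch_neq_0[OF assms(1,2,2)])
  have aq: "a * q ^ k < 1"
    by (rule mult_power_less_one[OF assms(1-3)])
  have summand: "qpoch r q (k + m) * qpoch \<beta> q (k + m)
            / (qpoch a q (k + m) * qpoch q q (k + m)) * q ^ (k + m)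
            * (w * qbinom q (k + m) k)
      = (qpoch r q k * w * q ^ k * qpoch \<beta> q k / (qpoch a q k * qpoch q q k)) *
        (qpoch (inverse (q ^ N)) q m * qpoch (\<beta> * q ^ k) q m
          / (qpoch (a * q ^ k) q m * qpoch q q m) * q ^ m)" for m
  proof -
    have "qpoch r q (k + m) * qpoch \<beta> q (k + m)
            / (qpoch a q (k + m) * qpoch q q (k + m)) * q ^ (k + m)
            * (w * qbinom q (k + m) k)
        = qpoch r q (k + m) * qpoch \<beta> q (k + m) / qpoch a q (k + m) * q ^ (k + m) * w
            * (qbinom q (k + m) k / qpoch q q (k + m))"
      by simp
    also have "qbinom q (k + m) k / qpoch q q (k + m) = 1 / (qpoch q q k * qpoch q q m)"
      using qbinom_qpoch[of q k m] nzq by (simp add: field_simps)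
    finally show ?thesis
      unfolding qpoch_add[of r] qpoch_add[of \<beta>] qpoch_add[of a] rq power_add by (simp add: mult_ac)
  qed
  \<comment> \<open>With \<open>n = k + N\<close> the exponent k (n + 1) equals k + k N + k k, so a
    factor \<open>q ^ (k * k)\<close> can be cancelled. The power \<open>q ^ (k * N)\<close> is
    supplied by \<open>prod_diff_eq_qpoch\<close>.\<close>
  have "(qpoch r q k * w * q ^ k * q ^ (k * N)) * q ^ (k * k)
      = qpoch r q k * w * q ^ (k * Suc n)"
    by (simp add: n_def power_add algebra_simps)
  also have "\<dots> = qpoch (q ^ n) (inverse q) k * q ^ (k * k)"
    unfolding r_def w_def using assms by (intro qpoch_inverse_power) simp
  finally have rw: "qpoch r q k * w * q ^ k * q ^ (k * N) = qpoch (q ^ n) (inverse q) k"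
    using assms by simp
  have "(\<Sum>m\<le>N. qpoch r q (k + m) * qpoch \<beta> q (k + m)
            / (qpoch a q (k + m) * qpoch q q (k + m)) * q ^ (k + m)
            * (w * qbinom q (k + m) k))
      = (qpoch r q k * w * q ^ k * qpoch \<beta> q k / (qpoch a q k * qpoch q q k)) *
        ((\<Prod>i<N. \<beta> * q ^ k - a * q ^ k * q ^ i) / qpoch (a * q ^ k) q N)"
    unfolding summand sum_distrib_left[symmetric] q_Chu_Vandermonde[OF assms(1,2) aq] ..
  also have "\<dots> = (qpoch r q k * w * q ^ k * q ^ (k * N)) * qpoch \<beta> q k
        * ((- a) ^ N * q ^ (N * (N - 1) div 2) * qpoch (b * q ^ k) q N)
        / (qpoch a q n * qpoch q q k)"
    unfolding \<beta>_def prod_diff_eq_qpoch by (simp add: n_def qpoch_add mult_ac)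
  also have "\<dots> = L_mat a b q n k"
    unfolding rw by (simp add: L_mat_def n_def \<beta>_def)
  finally show ?thesis unfolding r_def w_def .
qed

section \<open>The triangular factorization\<close>

lemma little_q_jacobi_eq_sum_L_U:
  assumes "0 < q" "q < 1" "a < 1"
  shows "little_q_jacobi a b q n x = (\<Sum>k\<le>n. L_mat a b q n k * U_mat q k x)"
proof -
  define T where "T j = qpoch (inverse (q ^ n)) q j * qpoch (a * b * q powi (int n - 1)) q j
            / (qpoch a q j * qpoch q q j) * q ^ j" for j
  define c where "c j k = (\<Prod>i<k. - (q ^ i)) * qbinom q j k" for j k
  have q0: "q \<noteq> 0" using assms by simp
  \<comment> \<open>The power q^((x+1)j) splits into (q^x)^j, to be expanded, and q^j, which stays
    in \<open>T\<close> and gives the 2phi1 its argument \<open>q\<close>.\<close>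
  have "little_q_jacobi a b q n x = (\<Sum>j\<le>n. T j * (q ^ x) ^ j)"
    unfolding little_q_jacobi_finite_sum[OF q0] T_def atMost_atLeast0
    by (intro sum.cong refl)
      (simp add: power_int_minus power_add algebra_simps power_mult[symmetric])
  also have "\<dots> = (\<Sum>j\<le>n. \<Sum>k\<le>j. T j * c j k * U_mat q k x)"
    unfolding power_eq_sum_qpoch_inverse[OF q0, of "q ^ x"] sum_distrib_left c_def U_mat_def
    by (simp add: mult.assoc)
  also have "\<dots> = (\<Sum>k\<le>n. \<Sum>m\<le>n - k. T (k + m) * c (k + m) k * U_mat q k x)"
    by (rule sum_triangle_shift)
  also have "\<dots> = (\<Sum>k\<le>n. L_mat a b q n k * U_mat q k x)"
  proof (intro sum.cong refl)
    fix k assume "k \<in> {..n}"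
    then have n: "k + (n - k) = n" by simp
    have "(\<Sum>m\<le>n - k. T (k + m) * c (k + m) k) = L_mat a b q n k"
      using little_q_jacobi_coefficient[OF assms, where k = k and N = "n - k" and b = b]
      unfolding n T_def c_def .
    then show "(\<Sum>m\<le>n - k. T (k + m) * c (k + m) k * U_mat q k x) = L_mat a b q n k * U_mat q k x"
      by (simp add: sum_distrib_right[symmetric])
  qed
  finally show ?thesis .
qed

theorem mainTheorem6:
  fixes a b q :: real
  assumes "0 < q" and "q < 1" and "0 < a" and "a < 1" and "b < 1"
  shows "lower_triangular (L_mat a b q)
    \<and> upper_triangular (U_mat q)
    \<and> P_mat a b q = inf_matrix_mult (L_mat a b q) (U_mat q)
    \<and> (\<forall>n x. little_q_jacobi a b q n x =
         (\<Sum>k=0..min n x.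
            q ^ ((n - k) * (n - k - 1) div 2) * (- a) ^ (n - k)
            * (qpoch (b * q ^ k) q (n - k) * qpoch (a * b * q powi (int n - 1)) q k
               / (qpoch a q n * qpoch q q k))
            * qpoch (q ^ n) (inverse q) k * qpoch (q ^ x) (inverse q) k))"
proof (intro conjI allI)
  have U0: "U_mat q k x = 0" if "x < k" for k x
    using that assms by (simp add: U_mat_def qpoch_inverse_eq_0)
  show "lower_triangular (L_mat a b q)"
    by (simp add: lower_triangular_def L_mat_def)
  show "upper_triangular (U_mat q)"
    by (simp add: upper_triangular_def U0)
  have expansion: "little_q_jacobi a b q n x = (\<Sum>k\<le>n. L_mat a b q n k * U_mat q k x)" for n x
    by (rule little_q_jacobi_eq_sum_L_U[OF assms(1,2,4)])
  show "P_mat a b q = inf_matrix_mult (L_mat a b q) (U_mat q)"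
  proof (intro ext)
    fix n x
    \<comment> \<open>Row \<open>n\<close> of \<open>L_mat\<close> vanishes beyond column
      \<open>n\<close>, so the series is a finite sum.\<close>
    have "(\<Sum>k. L_mat a b q n k * U_mat q k x) = (\<Sum>k\<le>n. L_mat a b q n k * U_mat q k x)"
      by (rule suminf_finite) (auto simp: L_mat_def)
    then show "P_mat a b q n x = inf_matrix_mult (L_mat a b q) (U_mat q) n x"
      by (simp add: P_mat_def inf_matrix_mult_def expansion)
  qed
  fix n x
  \<comment> \<open>The terms with \<open>x < k\<close> vanish by \<open>U0\<close>, which lowers
    the upper limit to \<open>min n x\<close>.\<close>
  have "(\<Sum>k\<le>n. L_mat a b q n k * U_mat q k x) = (\<Sum>k=0..min n x. L_mat a b q n k * U_mat q k x)"
    by (rule sum.mono_neutral_right) (auto simp: U0)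
  also have "\<dots> = (\<Sum>k=0..min n x.
            q ^ ((n - k) * (n - k - 1) div 2) * (- a) ^ (n - k)
            * (qpoch (b * q ^ k) q (n - k) * qpoch (a * b * q powi (int n - 1)) q k
               / (qpoch a q n * qpoch q q k))
            * qpoch (q ^ n) (inverse q) k * qpoch (q ^ x) (inverse q) k)"
    by (intro sum.cong refl) (simp add: L_mat_def U_mat_def)
  finally show "little_q_jacobi a b q n x = (\<Sum>k=0..min n x.
            q ^ ((n - k) * (n - k - 1) div 2) * (- a) ^ (n - k)
            * (qpoch (b * q ^ k) q (n - k) * qpoch (a * b * q powi (int n - 1)) q k
               / (qpoch a q n * qpoch q q k))
            * qpoch (q ^ n) (inverse q) k * qpoch (q ^ x) (inverse q) k)"
    unfolding expansion .
qed

end
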